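(* Let $p$ be a prime. (1) If $f\in\mathcal{K}_{p,1}$ or $f\in\mathcal{K}_{p,2}$, then $f$ has a fixed point $\tau\in\mathbb{Z}_p$. (2) If $f\in\mathcal{K}_{p,1}$ or $f\in\mathcal{K}_{p,2}$ and $f(0)\in\mathbb{Z}_p^*$, then $|f(s)|_p=1$ for all $s\in\mathbb{Z}_p$. (3) If $f\in\mathcal{W}_{p,2}$ with $f(0)\in p\mathbb{Z}_p$, then $f$ has a unique simple zero $\xi\in\mathbb{Z}_p$ and \[ f(s)=p(s-\xi)f^*(s),\qquad |f(s)|_p=|p(s-\xi)|_p,\qquad s\in\mathbb{Z}_p, \] where $f^*:\mathbb{Z}_p\to\mathbb{Z}_p^*$ is continuous and $f^*(s)\equiv\Delta_f\pmod{p\mathbb{Z}_p}$ for all $s$.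
   Context: For $f:\mathbb{Z}_p\to\mathbb{Z}_p$ and $n\ge0$ let $\Delta^n f(s)=\sum_{\nu=0}^n\binom{n}{\nu}(-1)^{n-\nu}f(s+\nu)$. $\mathcal{K}_{p,1}$ is the set of $f:\mathbb{Z}_p\to\mathbb{Z}_p$ such that for all $s\ne t$ in $\mathbb{Z}_p$ and all $n\ge0$: $s\equiv t\pmod{p^n}$ implies $f(s)\equiv f(t)\pmod{p^{n+1}}$. $\mathcal{K}_{p,2}$ is the set of $f:\mathbb{Z}_p\to\mathbb{Z}_p$ with $\Delta^n f(s)\equiv0\pmod{p^n\mathbb{Z}_p}$ for all $s\in\mathbb{Z}_p$, $n\ge0$. For $f\in\mathcal{K}_{p,2}$, $\Delta_f(n)=\Delta^nf(0)/p^n$, and $\Delta_f$ is the integer in $[0,p)$ congruent to $\Delta_f(1)$ mod $p$. $\mathcal{W}_{p,2}$ is the set of $f\in\mathcal{K}_{p,2}$ with $\Delta_f\ne0$ and, if $p=2$, additionally $2\mid\Delta_f(2)$. $\mathbb{Z}_p^*$ is the unit group of $\mathbb{Z}_p$.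
   Formalization: In the cases f in K_{p,2} and f in W_{p,2}, f is additionally assumed continuous on Z_p; without continuity the claim fails, e.g. f = 1/(1+p) on Z and 0 on Z_p \ Z lies in K_{p,2} but has no fixed point. *)

theory Defs
  imports Complex_Main "Berlekamp_Zassenhaus.Finite_Field"
begin

section \<open>The ring of p-adic integers\<close>

text \<open>
  The prime p is the cardinality of a type \<open>'p\<close> of class \<^class>\<open>prime_card\<close>.  A p-adic integer is a
  coherent sequence of residues: the n-th entry is the representative in \<open>{0..<p^n}\<close> of its
  class modulo \<open>p^n\<close>.
\<close>

typedef (overloaded) 'p padic_int =
  "{x :: nat \<Rightarrow> int. \<forall>n. x n \<in> {0..<int CARD('p::prime_card) ^ n} \<and> x (Suc n) mod int CARD('p) ^ n = x n}"
  morphisms res Abs_padic_int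
  using prime_card[where 'a='p] by (intro exI[of _ "\<lambda>_. 0"]) (auto dest: prime_gt_0_nat)

setup_lifting type_definition_padic_int

lemma CARD_pos: "int CARD('p::prime_card) > 0"
  using prime_card[where 'a='p] by (simp add: prime_gt_0_nat)

lemma mod_mod_power_int: "m \<le> n \<Longrightarrow> (a mod p ^ n) mod p ^ m = a mod (p ^ m :: int)"
  by (simp add: le_imp_power_dvd mod_mod_cancel)

lemma res_mod: "res (x::'p::prime_card padic_int) n mod int CARD('p) ^ n = res x n"
  using res[of x] by auto

lemma res_mod_le:
  fixes x :: "'p::prime_card padic_int"
  assumes "m \<le> n" shows "res x n mod int CARD('p) ^ m = res x m"
  using assms
proof (induction n rule: dec_induct)
  case base
  show ?case by (rule res_mod)
next
  case (step n)
  have "res x (Suc n) mod int CARD('p) ^ m = (res x (Suc n) mod int CARD('p) ^ n) mod int CARD('p) ^ m"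
    using step by (simp add: mod_mod_power_int)
  also have "res x (Suc n) mod int CARD('p) ^ n = res x n" using res[of x] by auto
  finally show ?case using step by simp
qed

lemma coherentI:
  fixes a :: "nat \<Rightarrow> int" and p :: int
  assumes "p > 0" and "\<And>n. a (Suc n) mod p ^ n = a n mod p ^ n"
  shows "(a n mod p ^ n) \<in> {0..<p ^ n} \<and> (a (Suc n) mod p ^ Suc n) mod p ^ n = a n mod p ^ n"
  using assms mod_mod_power_int[of n "Suc n" "a (Suc n)" p] by auto

instantiation padic_int :: (prime_card) comm_ring_1
begin

lift_definition zero_padic_int :: "'a padic_int" is "\<lambda>n. 0 mod int CARD('a) ^ n"
  using CARD_pos[where 'p='a] by auto

lift_definition one_padic_int :: "'a padic_int" is "\<lambda>n. 1 mod int CARD('a) ^ n"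
  by (intro allI coherentI CARD_pos) auto

lift_definition plus_padic_int :: "'a padic_int \<Rightarrow> 'a padic_int \<Rightarrow> 'a padic_int"
  is "\<lambda>x y n. (x n + y n) mod int CARD('a) ^ n"
  by (intro allI coherentI CARD_pos mod_add_cong) auto

lift_definition uminus_padic_int :: "'a padic_int \<Rightarrow> 'a padic_int"
  is "\<lambda>x n. (- x n) mod int CARD('a) ^ n"
  by (intro allI coherentI CARD_pos mod_minus_cong) auto

lift_definition minus_padic_int :: "'a padic_int \<Rightarrow> 'a padic_int \<Rightarrow> 'a padic_int"
  is "\<lambda>x y n. (x n - y n) mod int CARD('a) ^ n"
  by (intro allI coherentI CARD_pos mod_diff_cong) auto

lift_definition times_padic_int :: "'a padic_int \<Rightarrow> 'a padic_int \<Rightarrow> 'a padic_int"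
  is "\<lambda>x y n. (x n * y n) mod int CARD('a) ^ n"
  by (intro allI coherentI CARD_pos mod_mult_cong) auto

instance
proof
  fix a b c :: "'a padic_int"
  show "a * b * c = a * (b * c)" by transfer (auto simp: fun_eq_iff mod_simps algebra_simps)
  show "a * b = b * a" by transfer (auto simp: mult.commute)
  show "1 * a = a" by transfer (auto simp: fun_eq_iff mod_simps)
  show "a + b + c = a + (b + c)" by transfer (auto simp: fun_eq_iff mod_simps algebra_simps)
  show "a + b = b + a" by transfer (auto simp: add.commute)
  show "0 + a = a" by transfer (auto simp: fun_eq_iff)
  show "- a + a = 0" by transfer (auto simp: fun_eq_iff mod_simps)
  show "a - b = a + - b" by transfer (auto simp: fun_eq_iff mod_simps)
  show "(a + b) * c = a * c + b * c" by transfer (auto simp: fun_eq_iff mod_simps algebra_simps)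
  have "res (0::'a padic_int) 1 \<noteq> res (1::'a padic_int) 1"
    using prime_gt_1_nat[OF prime_card[where 'a='a]]
    by (simp add: zero_padic_int.rep_eq one_padic_int.rep_eq)
  then show "(0::'a padic_int) \<noteq> 1" by metis
qed

end

lemma padic_eqI: "(\<And>n. res x n = res y n) \<Longrightarrow> x = y"
  by transfer auto

lemma res_zero [simp]: "res (0::'p::prime_card padic_int) n = 0"
  by transfer simp

lemma res_of_nat: "res (of_nat k :: 'p::prime_card padic_int) n = int k mod int CARD('p) ^ n"
proof (induction k)
  case (Suc k)
  have "res (of_nat (Suc k) :: 'p padic_int) n =
      (res (1::'p padic_int) n + res (of_nat k :: 'p padic_int) n) mod int CARD('p) ^ n"
    by (simp add: plus_padic_int.rep_eq)
  also have "\<dots> = int (Suc k) mod int CARD('p) ^ n"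
    by (simp add: Suc one_padic_int.rep_eq mod_simps)
  finally show ?case .
qed simp

abbreviation padic_p :: "'p::prime_card padic_int"
  where "padic_p \<equiv> of_nat CARD('p)"

lemma padic_p_power_dvd_iff:
  fixes x :: "'p::prime_card padic_int"
  shows "padic_p ^ n dvd x \<longleftrightarrow> res x n = 0"
proof
  assume "padic_p ^ n dvd x"
  then obtain y where "x = padic_p ^ n * y" by (elim dvdE)
  then have "x = of_nat (CARD('p) ^ n) * y" by simp
  then show "res x n = 0" by (simp add: times_padic_int.rep_eq res_of_nat flip: of_nat_power)
next
  assume x0: "res x n = 0"
  let ?p = "int CARD('p)"
  define y where "y k = res x (n + k) div ?p ^ n" for k
  have p0: "?p > 0" by (rule CARD_pos)
  have xy: "res x (n + k) = ?p ^ n * y k" for k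
    using res_mod_le[of n "n + k" x] x0 by (auto simp: y_def)
  have "y k \<in> {0..<?p ^ k} \<and> y (Suc k) mod ?p ^ k = y k" for k
  proof -
    have "0 \<le> ?p ^ n * y k \<and> ?p ^ n * y k < ?p ^ n * ?p ^ k"
      using res[of x] xy[of k] by (metis (no_types, lifting) atLeastLessThan_iff mem_Collect_eq power_add)
    then have "y k \<in> {0..<?p ^ k}"
      using zero_less_power[OF p0, of n] by (simp add: zero_le_mult_iff)
    moreover have "?p ^ n * (y (Suc k) mod ?p ^ k) = ?p ^ n * y k"
      unfolding mult_mod_right power_add[symmetric] xy[symmetric] by (rule res_mod_le) simp
    ultimately show ?thesis using p0 by simp
  qed
  then have res_y: "res (Abs_padic_int y :: 'p padic_int) = y"
    by (intro Abs_padic_int_inverse) auto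
  have "x = of_nat (CARD('p) ^ n) * Abs_padic_int y"
  proof (rule padic_eqI)
    fix k
    have "res x k = res x (n + k) mod ?p ^ k" by (simp add: res_mod_le)
    then show "res x k = res (of_nat (CARD('p) ^ n) * Abs_padic_int y :: 'p padic_int) k"
      by (simp add: times_padic_int.rep_eq res_of_nat res_y xy mod_simps flip: of_nat_power)
  qed
  then show "padic_p ^ n dvd x" by simp
qed

lemma padic_eq_0_iff: "(x::'p::prime_card padic_int) = 0 \<longleftrightarrow> (\<forall>n. padic_p ^ n dvd x)"
  by (auto simp: padic_p_power_dvd_iff intro: padic_eqI)

lemma prime_power_dvd_multD:
  fixes a b p :: int
  assumes "prime p" "p ^ (m + n) dvd a * b"
  shows "p ^ m dvd a \<or> p ^ n dvd b"
proof (cases "a = 0 \<or> b = 0")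
  case False
  have "m + n \<le> multiplicity p (a * b)"
    using assms False by (intro multiplicity_geI) auto
  also have "\<dots> = multiplicity p a + multiplicity p b"
    using assms False by (intro prime_elem_multiplicity_mult_distrib) auto
  finally have "m \<le> multiplicity p a \<or> n \<le> multiplicity p b" by linarith
  then show ?thesis by (auto intro: multiplicity_dvd')
qed auto

instantiation padic_int :: (prime_card) idom_divide
begin

text \<open>Only exact division matters; \<open>x div y\<close> is 0 when \<open>y\<close> does not divide \<open>x\<close>.\<close>

definition divide_padic_int :: "'a padic_int \<Rightarrow> 'a padic_int \<Rightarrow> 'a padic_int" where
  "divide_padic_int x y = (if y \<noteq> 0 \<and> y dvd x then (THE c. x = c * y) else 0)"

instance
proof
  have no_zd: "a * b \<noteq> 0" if ne: "a \<noteq> 0" "b \<noteq> 0" for a b :: "'a padic_int"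
  proof
    assume ab: "a * b = 0"
    let ?p = "int CARD('a)"
    obtain m n where mn: "\<not> padic_p ^ m dvd a" "\<not> padic_p ^ n dvd b"
      using ne unfolding padic_eq_0_iff by auto
    have "res (a * b) (m + n) = 0" by (simp add: ab)
    then have "?p ^ (m + n) dvd res a (m + n) * res b (m + n)"
      by (auto simp: times_padic_int.rep_eq)
    then have "?p ^ m dvd res a (m + n) \<or> ?p ^ n dvd res b (m + n)"
      by (intro prime_power_dvd_multD) (use prime_card[where 'a='a] in auto)
    then show False
      using mn res_mod_le[of m "m + n" a] res_mod_le[of n "m + n" b]
      by (auto simp: padic_p_power_dvd_iff)
  qed
  fix a b :: "'a padic_int"
  show "a \<noteq> 0 \<Longrightarrow> b \<noteq> 0 \<Longrightarrow> a * b \<noteq> 0" by (rule no_zd)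
  show "a div 0 = 0" by (simp add: divide_padic_int_def)
  assume b: "b \<noteq> 0"
  have "c = a" if "a * b = c * b" for c
  proof -
    have "(c - a) * b = 0" using that by (simp add: algebra_simps)
    then show "c = a" using b no_zd[of "c - a" b] by auto
  qed
  then have "(THE c. a * b = c * b) = a" by (intro the_equality) auto
  then show "a * b div b = a" using b by (simp add: divide_padic_int_def)
qed

end

section \<open>The p-adic absolute value and the p-adic topology\<close>

definition padic_abs :: "'p::prime_card padic_int \<Rightarrow> real" where
  "padic_abs x = (if x = 0 then 0 else (1 / real CARD('p)) ^ Max {n. padic_p ^ n dvd x})"

lemma finite_padic_p_powers:
  fixes x :: "'p::prime_card padic_int"
  assumes "x \<noteq> 0" shows "finite {n. padic_p ^ n dvd x}"
proof -
  obtain m where m: "\<not> padic_p ^ m dvd x" using assms padic_eq_0_iff by blast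
  have "n < m" if "padic_p ^ n dvd x" for n
  proof (rule ccontr)
    assume "\<not> n < m"
    then have "padic_p ^ m dvd x" using that by (meson le_imp_power_dvd dvd_trans not_less)
    with m show False by simp
  qed
  then show ?thesis by (auto intro: finite_subset[OF _ finite_lessThan[of m]])
qed

lemma padic_abs_le_iff:
  fixes x :: "'p::prime_card padic_int"
  shows "padic_abs x \<le> (1 / real CARD('p)) ^ n \<longleftrightarrow> padic_p ^ n dvd x"
proof (cases "x = 0")
  case False
  have p1: "real CARD('p) > 1" using prime_card[where 'a='p] prime_gt_1_nat by force
  let ?M = "Max {n. padic_p ^ n dvd x}"
  have dvd_M: "padic_p ^ ?M dvd x"
    using Max_in[OF finite_padic_p_powers[OF False]] by (metis (mono_tags, lifting) empty_iff mem_Collect_eq one_dvd power_0)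
  have "padic_abs x \<le> (1 / real CARD('p)) ^ n \<longleftrightarrow> n \<le> ?M"
    using False p1 by (simp add: padic_abs_def power_one_over divide_simps power_increasing_iff)
  also have "\<dots> \<longleftrightarrow> padic_p ^ n dvd x"
    using Max_ge[OF finite_padic_p_powers[OF False], of n] dvd_M
    by (auto intro: dvd_trans[OF le_imp_power_dvd])
  finally show ?thesis .
qed (simp add: padic_abs_def)

lemma padic_abs_nonneg: "padic_abs x \<ge> 0"
  by (simp add: padic_abs_def)

lemma padic_abs_eq_0_iff: "padic_abs (x::'p::prime_card padic_int) = 0 \<longleftrightarrow> x = 0"
  using CARD_pos[where 'p='p] by (simp add: padic_abs_def)

lemma padic_abs_add_le:
  fixes x y :: "'p::prime_card padic_int"
  shows "padic_abs (x + y) \<le> max (padic_abs x) (padic_abs y)"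
proof (cases "x = 0 \<or> y = 0")
  case False
  have main: "padic_abs (x + y) \<le> padic_abs x"
    if "padic_abs y \<le> padic_abs x" "x \<noteq> 0" for x y :: "'p padic_int"
  proof -
    define n where "n = Max {n. padic_p ^ n dvd x}"
    have x: "padic_abs x = (1 / real CARD('p)) ^ n" using that by (simp add: padic_abs_def n_def)
    then have "padic_p ^ n dvd x" "padic_p ^ n dvd y" using that by (simp_all flip: padic_abs_le_iff)
    then show ?thesis unfolding x padic_abs_le_iff by simp
  qed
  show ?thesis
    using main[of y x] main[of x y] False by (auto simp: max_def add.commute)
qed (auto simp: padic_abs_nonneg max_def)

lemma padic_abs_minus: "padic_abs (x - y) = padic_abs (y - (x::'p::prime_card padic_int))"
proof -
  have "padic_abs (- z) = padic_abs z" for z :: "'p padic_int"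
    by (simp add: padic_abs_def)
  from this[of "y - x"] show ?thesis by simp
qed

instantiation padic_int :: (prime_card) metric_space
begin

definition dist_padic_int :: "'a padic_int \<Rightarrow> 'a padic_int \<Rightarrow> real" where
  "dist_padic_int x y = padic_abs (x - y)"

definition uniformity_padic_int :: "('a padic_int \<times> 'a padic_int) filter" where
  "uniformity_padic_int = (INF e\<in>{0 <..}. principal {(x, y). dist x y < e})"

definition open_padic_int :: "'a padic_int set \<Rightarrow> bool" where
  "open_padic_int U \<longleftrightarrow> (\<forall>x\<in>U. eventually (\<lambda>(x', y). x' = x \<longrightarrow> y \<in> U) uniformity)"

instance
proof
  fix x y z :: "'a padic_int"
  show "(dist x y = 0) = (x = y)"
    by (simp add: dist_padic_int_def padic_abs_eq_0_iff)
  have "dist x y \<le> max (padic_abs (x - z)) (padic_abs (z - y))"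
    using padic_abs_add_le[of "x - z" "z - y"] by (simp add: dist_padic_int_def)
  then show "dist x y \<le> dist x z + dist y z"
    using padic_abs_nonneg[of "x - z"] padic_abs_nonneg[of "z - y"]
    by (simp add: dist_padic_int_def padic_abs_minus[of y z])
qed (simp_all only: uniformity_padic_int_def open_padic_int_def)

end

text \<open>
  A simple zero is a zero at which the derivative exists and does not vanish.  The condition on
  \<open>D\<close> says that \<open>(f s - f \<xi>) / (s - \<xi>)\<close> tends to \<open>D\<close> as \<open>s\<close> tends to \<open>\<xi>\<close>, written without division.
\<close>

definition has_padic_derivative ::
    "('p::prime_card padic_int \<Rightarrow> 'p padic_int) \<Rightarrow> 'p padic_int \<Rightarrow> 'p padic_int \<Rightarrow> bool" where
  "has_padic_derivative f D \<xi> \<longleftrightarrow>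
     (\<forall>\<epsilon>>0. \<exists>\<delta>>0. \<forall>s. padic_abs (s - \<xi>) < \<delta> \<longrightarrow>
        padic_abs (f s - f \<xi> - D * (s - \<xi>)) \<le> \<epsilon> * padic_abs (s - \<xi>))"

definition simple_zero :: "('p::prime_card padic_int \<Rightarrow> 'p padic_int) \<Rightarrow> 'p padic_int \<Rightarrow> bool" where
  "simple_zero f \<xi> \<longleftrightarrow> f \<xi> = 0 \<and> (\<exists>D. D \<noteq> 0 \<and> has_padic_derivative f D \<xi>)"

section \<open>The function spaces\<close>

definition fwd_diff ::
    "nat \<Rightarrow> ('p::prime_card padic_int \<Rightarrow> 'p padic_int) \<Rightarrow> 'p padic_int \<Rightarrow> 'p padic_int" where
  "fwd_diff n f s = (\<Sum>\<nu>=0..n. of_nat (n choose \<nu>) * (- 1) ^ (n - \<nu>) * f (s + of_nat \<nu>))"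

definition K1 :: "('p::prime_card padic_int \<Rightarrow> 'p padic_int) set" where
  "K1 = {f. \<forall>s t. s \<noteq> t \<longrightarrow> (\<forall>n. padic_p ^ n dvd (s - t) \<longrightarrow> padic_p ^ (n + 1) dvd (f s - f t))}"

definition K2 :: "('p::prime_card padic_int \<Rightarrow> 'p padic_int) set" where
  "K2 = {f. \<forall>s n. padic_p ^ n dvd fwd_diff n f s}"

definition Delta_quot :: "('p::prime_card padic_int \<Rightarrow> 'p padic_int) \<Rightarrow> nat \<Rightarrow> 'p padic_int" where
  "Delta_quot f n = fwd_diff n f 0 div padic_p ^ n"

definition Delta_res :: "('p::prime_card padic_int \<Rightarrow> 'p padic_int) \<Rightarrow> int" where
  "Delta_res f = (THE d. d \<in> {0..<int CARD('p)} \<and> padic_p dvd (of_int d - Delta_quot f 1))"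

lemma Delta_res_ex1:
  fixes f :: "'p::prime_card padic_int \<Rightarrow> 'p padic_int"
  shows "\<exists>!d. d \<in> {0..<int CARD('p)} \<and> padic_p dvd (of_int d - Delta_quot f 1)"
proof -
  let ?a = "Delta_quot f 1"
  have "padic_p dvd (of_int d - ?a) \<longleftrightarrow> d = res ?a 1" if "d \<in> {0..<int CARD('p)}" for d
  proof -
    have "padic_p dvd (of_int d - ?a) \<longleftrightarrow> res (of_nat (nat d) - ?a) 1 = 0"
      using that padic_p_power_dvd_iff[of 1 "of_int d - ?a"] by (simp add: of_nat_nat)
    also have "\<dots> \<longleftrightarrow> (d - res ?a 1) mod int CARD('p) = 0"
      using that by (simp add: minus_padic_int.rep_eq res_of_nat del: of_nat_nat)
    also have "\<dots> \<longleftrightarrow> d mod int CARD('p) = res ?a 1 mod int CARD('p)"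
      by (simp add: mod_eq_dvd_iff dvd_eq_mod_eq_0)
    also have "\<dots> \<longleftrightarrow> d = res ?a 1"
      using that res_mod[of ?a 1] by simp
    finally show ?thesis .
  qed
  moreover have "res ?a 1 \<in> {0..<int CARD('p)}" using res[of ?a] by (auto dest: spec[of _ 1])
  ultimately show ?thesis by blast
qed

definition W2 :: "('p::prime_card padic_int \<Rightarrow> 'p padic_int) set" where
  "W2 = {f \<in> K2. Delta_res f \<noteq> 0 \<and> (CARD('p) = 2 \<longrightarrow> 2 dvd Delta_quot f 2)}"

text \<open>
  Membership in \<^const>\<open>K2\<close> only constrains \<open>f\<close> along each coset of the rational integers separately,
  so it does not imply continuity, and a discontinuous member need not have a fixed point.
  Results about \<^const>\<open>K2\<close> and \<^const>\<open>W2\<close> therefore take continuity as an explicit assumption.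
\<close>

lemma K2_fixed_point_free:
  "\<exists>f :: 'p::prime_card padic_int \<Rightarrow> 'p padic_int. f \<in> K2 \<and> (\<forall>s. f s \<noteq> s)"
proof -
  let ?p = "int CARD('p)"
  have p1: "?p > 1" using prime_card[where 'a='p] prime_gt_1_nat by force
  define a where "a n = (\<Sum>k<n. (- ?p) ^ k)" for n
  define b where "b n = a n mod ?p ^ n" for n
  have "b n \<in> {0..<?p ^ n} \<and> b (Suc n) mod ?p ^ n = b n" for n
    unfolding b_def
  proof (rule coherentI)
    fix n
    have "?p ^ n dvd a (Suc n) - a n" by (simp add: a_def power_minus[of ?p])
    then show "a (Suc n) mod ?p ^ n = a n mod ?p ^ n" by (simp add: mod_eq_dvd_iff)
  qed (use p1 in simp)
  then have res_b: "res (Abs_padic_int b :: 'p padic_int) = b"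
    by (intro Abs_padic_int_inverse) auto
  define c :: "'p padic_int" where "c = Abs_padic_int b"
  have geo: "(1 + ?p) * a n = 1 - (- ?p) ^ n" for n
    by (induction n) (auto simp: a_def algebra_simps)
  have c: "of_nat (1 + CARD('p)) * c = 1"
  proof (rule padic_eqI)
    fix n
    have "res (of_nat (1 + CARD('p)) * c) n = ((1 + ?p) * a n) mod ?p ^ n"
      unfolding times_padic_int.rep_eq res_of_nat
      by (simp add: res_b c_def b_def mod_simps)
    also have "\<dots> = 1 mod ?p ^ n"
      unfolding geo by (simp add: mod_eq_dvd_iff power_minus[of ?p])
    finally show "res (of_nat (1 + CARD('p)) * c) n = res (1 :: 'p padic_int) n" by (simp add: one_padic_int.rep_eq)
  qed
  have inj: "k = 0" if "(of_int k :: 'p padic_int) = 0" for k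
  proof -
    have "(of_nat (nat \<bar>k\<bar>) :: 'p padic_int) = 0"
      using that by (cases "k \<ge> 0") (auto simp: of_nat_nat)
    then have "int (nat \<bar>k\<bar>) mod ?p ^ nat \<bar>k\<bar> = 0"
      using res_of_nat[of "nat \<bar>k\<bar>" "nat \<bar>k\<bar>", where 'p='p] by simp
    moreover have "int (nat \<bar>k\<bar>) < ?p ^ nat \<bar>k\<bar>"
    proof -
      have "nat \<bar>k\<bar> < CARD('p) ^ nat \<bar>k\<bar>" using p1 by (intro power_gt_expt) auto
      then show ?thesis by (metis of_nat_less_iff of_nat_power)
    qed
    ultimately show "k = 0" by simp
  qed
  have c_nonint: "c \<notin> \<int>"
  proof
    assume "c \<in> \<int>"
    then obtain m where "c = of_int m" by (elim Ints_cases)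
    with c have "(of_int ((1 + ?p) * m - 1) :: 'p padic_int) = 0" by simp
    then have "(1 + ?p) * m = 1" using inj by fastforce
    then show False using p1 zmult_eq_1_iff[of "1 + ?p" m] by auto
  qed
  define f :: "'p padic_int \<Rightarrow> 'p padic_int" where "f s = (if s \<in> \<int> then c else 0)" for s
  have shift: "s + of_nat k \<in> \<int> \<longleftrightarrow> s \<in> \<int>" for s :: "'p padic_int" and k
    by (metis Ints_add Ints_diff Ints_of_nat add_diff_cancel)
  have "padic_p ^ n dvd fwd_diff n f s" for s n
  proof (cases n)
    case (Suc m)
    have "fwd_diff n f s = (\<Sum>\<nu>\<le>n. of_nat (n choose \<nu>) * (- 1) ^ (n - \<nu>)) * f s"
      unfolding fwd_diff_def sum_distrib_right by (auto simp: f_def shift atLeast0AtMost)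
    also have "(\<Sum>\<nu>\<le>n. of_nat (n choose \<nu>) * (- 1) ^ (n - \<nu>)) = (1 + (- 1) :: 'p padic_int) ^ n"
      by (subst binomial_ring) simp
    finally show ?thesis using Suc by simp
  qed simp
  moreover have "f s \<noteq> s" for s using c_nonint by (auto simp: f_def)
  ultimately show ?thesis by (auto simp: K2_def)
qed

end

theory Submission
  imports Defs
begin

text \<open>
  In the Newton expansion \<open>f (s + h) = (\<Sum>n. (h choose n) * \<Delta>\<^sup>n f s)\<close> write
  \<open>(h choose n) = h / n * (h - 1 choose n - 1)\<close>.  For \<open>f\<close> in K2 the n-th term is then \<open>p * h\<close> times
  a p-adic integer whose coefficient \<open>\<Delta>\<^sup>n f s / (p * n)\<close> tends to 0.  With continuity this puts \<open>f\<close>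
  into K1, whose members are contractions and so have fixed points.  It also shows that
  \<open>(f (s + h) - f s) / (p * h)\<close> extends continuously to \<open>h = 0\<close>, so \<open>f\<close> is differentiable.
  For \<open>f\<close> in W2 only the term \<open>n = 1\<close> survives mod p, so this quotient is congruent to the unit
  \<open>\<Delta>\<^sub>f\<close>.  Hence \<open>s \<mapsto> s - f s / (p * \<Delta>\<^sub>f)\<close> is in K1; its fixed point is the zero \<open>\<xi>\<close>, and the
  quotient based at \<open>\<xi>\<close> is \<open>f\<^sup>*\<close>.
\<close>

section \<open>Divisibility by powers of p\<close>

lemma dvd_diff_swap: "a dvd b - c \<Longrightarrow> a dvd c - (b :: 'a::comm_ring_1)"
  using dvd_minus_iff[of a "b - c"] by simp

lemma padic_p_power_dvd_diff_iff:
  fixes x y :: "'p::prime_card padic_int"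
  shows "padic_p ^ n dvd x - y \<longleftrightarrow> res x n = res y n"
proof -
  have "padic_p ^ n dvd x - y \<longleftrightarrow> (res x n - res y n) mod int CARD('p) ^ n = 0"
    by (simp add: padic_p_power_dvd_iff minus_padic_int.rep_eq)
  also have "\<dots> \<longleftrightarrow> res x n mod int CARD('p) ^ n = res y n mod int CARD('p) ^ n"
    by (simp add: mod_eq_dvd_iff dvd_eq_mod_eq_0)
  finally show ?thesis by (simp add: res_mod)
qed

lemma padic_p_power_dvd_of_nat_iff:
  "(padic_p :: 'p::prime_card padic_int) ^ n dvd of_nat k \<longleftrightarrow> CARD('p) ^ n dvd k"
proof -
  have "(padic_p :: 'p padic_int) ^ n dvd of_nat k \<longleftrightarrow> int CARD('p) ^ n dvd int k"
    by (simp add: padic_p_power_dvd_iff res_of_nat dvd_eq_mod_eq_0)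
  then show ?thesis by (metis of_nat_dvd_iff of_nat_power)
qed

text \<open>Characteristic zero: otherwise p^k would divide k, although k < p^k.\<close>

lemma padic_of_nat_eq_0_iff: "(of_nat k :: 'p::prime_card padic_int) = 0 \<longleftrightarrow> k = 0"
proof
  assume "(of_nat k :: 'p padic_int) = 0"
  then have "CARD('p) ^ k dvd k" by (simp flip: padic_p_power_dvd_of_nat_iff)
  moreover have "k < CARD('p) ^ k"
    using prime_gt_1_nat[OF prime_card[where 'a='p]] by (intro power_gt_expt) auto
  ultimately show "k = 0" using nat_dvd_not_less[of k] by blast
qed simp

lemma padic_p_nonzero: "(padic_p :: 'p::prime_card padic_int) \<noteq> 0"
  using CARD_pos[where 'p='p] by (simp add: padic_of_nat_eq_0_iff)

text \<open>The natural numbers are dense, the n-th residue of \<open>x\<close> being such an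
  \<open>h\<close>. Congruences proved for natural arguments extend to p-adic ones through
  this.\<close>

lemma padic_nat_approx:
  fixes x :: "'p::prime_card padic_int"
  obtains h where "padic_p ^ n dvd x - of_nat h"
proof
  have "0 \<le> res x n" using res[of x] by auto
  then show "padic_p ^ n dvd x - of_nat (nat (res x n))"
    by (simp add: padic_p_power_dvd_diff_iff res_of_nat res_mod del: of_nat_nat)
qed

section \<open>Completeness and contractions\<close>

text \<open>The n-th residue no longer changes from \<open>a n\<close> on, so the residues
  \<open>res (a n) n\<close> are coherent and form the limit.\<close>

lemma padic_complete:
  fixes a :: "nat \<Rightarrow> 'p::prime_card padic_int"
  assumes "\<And>n. padic_p ^ n dvd a (Suc n) - a n"
  obtains L where "\<And>n. padic_p ^ n dvd L - a n"
proof -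
  define b where "b n = res (a n) n" for n
  have "b n \<in> {0..<int CARD('p) ^ n} \<and> b (Suc n) mod int CARD('p) ^ n = b n" for n
    using res[of "a n"] assms[of n] res_mod_le[of n "Suc n" "a (Suc n)"]
    by (auto simp: b_def padic_p_power_dvd_diff_iff)
  then have "res (Abs_padic_int b :: 'p padic_int) = b"
    by (intro Abs_padic_int_inverse) auto
  then have "padic_p ^ n dvd Abs_padic_int b - a n" for n
    by (simp add: padic_p_power_dvd_diff_iff b_def)
  then show thesis by (rule that)
qed

lemma K1D:
  assumes "f \<in> K1" "padic_p ^ n dvd s - t"
  shows "padic_p ^ Suc n dvd f s - f t"
  using assms by (cases "s = t") (auto simp: K1_def)

text \<open>A member of \<open>K1\<close> contracts by the factor 1/p, so iteration from 0 gains one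
  power of p per step and converges.\<close>

lemma K1_fixed_point:
  fixes f :: "'p::prime_card padic_int \<Rightarrow> 'p padic_int"
  assumes f: "f \<in> K1"
  obtains \<tau> where "f \<tau> = \<tau>"
proof -
  define a where "a n = (f ^^ n) 0" for n
  have a_Suc: "a (Suc n) = f (a n)" for n by (simp add: a_def)
  have "padic_p ^ n dvd a (Suc n) - a n" for n
  proof (induction n)
    case (Suc n)
    from K1D[OF f Suc] show ?case by (simp only: a_Suc)
  qed simp
  then obtain \<tau> where \<tau>: "\<And>n. padic_p ^ n dvd \<tau> - a n" using padic_complete by blast
  have "padic_p ^ n dvd f \<tau> - \<tau>" for n
  proof -
    \<comment> \<open>Since \<open>a (Suc n) = f (a n)\<close>, these two terms cancel.\<close>
    have "padic_p ^ Suc n dvd (f \<tau> - f (a n)) - (\<tau> - a (Suc n))"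
      by (intro dvd_diff K1D[OF f] \<tau>)
    then have "padic_p ^ Suc n dvd f \<tau> - \<tau>" by (simp add: a_Suc)
    then show ?thesis by (rule dvd_trans[OF le_imp_power_dvd, rotated]) simp
  qed
  then have "f \<tau> - \<tau> = 0" unfolding padic_eq_0_iff by blast
  then show thesis by (intro that) simp
qed

text \<open>The inverse of \<open>x\<close> is a fixed point of \<open>s \<mapsto> s - c * (x * s - 1)\<close>, where \<open>c\<close> inverts \<open>x\<close> mod p.\<close>

lemma padic_unit_iff:
  fixes x :: "'p::prime_card padic_int"
  shows "x dvd 1 \<longleftrightarrow> \<not> padic_p dvd x"
proof
  assume "x dvd 1"
  show "\<not> padic_p dvd x"
  proof
    assume "padic_p dvd x"
    with \<open>x dvd 1\<close> have "(padic_p :: 'p padic_int) dvd 1" by (rule dvd_trans[rotated])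
    then have "CARD('p) ^ 1 dvd 1"
      unfolding padic_p_power_dvd_of_nat_iff[of 1 1, where 'p='p, symmetric] by simp
    then show False using prime_gt_1_nat[OF prime_card[where 'a='p]] by simp
  qed
next
  let ?p = "CARD('p)"
  assume x: "\<not> padic_p dvd x"
  \<comment> \<open>Modulo p, \<open>x\<close> is a natural number, so \<open>c\<close> comes from
    inversion modulo a prime.\<close>
  obtain h where h: "padic_p dvd x - of_nat h" using padic_nat_approx[of 1 x] by auto
  have "\<not> padic_p dvd (of_nat h :: 'p padic_int)"
    using h x dvd_add[of padic_p "x - of_nat h" "of_nat h"] by auto
  then have "\<not> ?p dvd h" using padic_p_power_dvd_of_nat_iff[of 1 h, where 'p='p] by simp
  then have "coprime h ?p"
    using prime_card[where 'a='p] by (metis coprime_commute prime_imp_coprime)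
  then obtain c where c: "[h * c = Suc 0] (mod ?p)" using cong_solve_coprime_nat by blast
  have "int (h * c) mod int ?p = 1 mod int ?p"
    using c unfolding cong_def by (metis One_nat_def of_nat_1 of_nat_mod)
  then have "padic_p ^ 1 dvd (of_nat (h * c) :: 'p padic_int) - of_nat 1"
    unfolding padic_p_power_dvd_diff_iff res_of_nat by simp
  then have "padic_p dvd of_nat c * (x - of_nat h) + (of_nat (h * c) - 1)"
    using h by simp
  then have cx: "padic_p dvd of_nat c * x - 1" by (simp add: algebra_simps)
  define F where "F s = s - of_nat c * (x * s - 1)" for s
  have "F \<in> K1"
    unfolding K1_def
  proof (intro CollectI allI impI)
    fix s t :: "'p padic_int" and n
    assume "padic_p ^ n dvd s - t"
    then have "padic_p ^ n * padic_p dvd (s - t) * (- (of_nat c * x - 1))"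
      using cx by (intro mult_dvd_mono) (simp_all only: dvd_minus_iff)
    moreover have "(s - t) * (- (of_nat c * x - 1)) = F s - F t"
      by (simp add: F_def algebra_simps)
    ultimately show "padic_p ^ (n + 1) dvd F s - F t" by (simp add: mult.commute)
  qed
  then obtain s where "F s = s" by (rule K1_fixed_point)
  then have "(of_nat c :: 'p padic_int) = 0 \<or> x * s - 1 = 0" by (simp add: F_def)
  moreover have "(of_nat c :: 'p padic_int) \<noteq> 0"
  proof
    assume "(of_nat c :: 'p padic_int) = 0"
    then have "(padic_p :: 'p padic_int) dvd - 1" using cx by simp
    then have "(padic_p :: 'p padic_int) dvd x"
      by (metis dvd_minus_iff one_dvd dvd_trans)
    then show False using x by simp
  qed
  ultimately have "1 = x * s" by simp
  then show "x dvd 1" by (rule dvdI)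
qed

section \<open>Valuations\<close>

text \<open>For \<open>i\<close> the largest exponent with p^i dividing \<open>x\<close>, the
  cofactor is not divisible by p and hence a unit.\<close>

lemma padic_decompose:
  fixes x :: "'p::prime_card padic_int"
  assumes "x \<noteq> 0"
  obtains i w where "x = padic_p ^ i * w" "w dvd 1"
proof -
  let ?S = "{n. padic_p ^ n dvd x}"
  have "Max ?S \<in> ?S"
    by (rule Max_in[OF finite_padic_p_powers[OF assms]]) (auto intro!: exI[of _ 0])
  then obtain w where w: "x = padic_p ^ Max ?S * w" by (auto elim: dvdE)
  have "\<not> padic_p dvd w"
  proof
    assume "padic_p dvd w"
    then have "padic_p ^ Suc (Max ?S) dvd x"
      by (subst w) (simp add: mult.commute mult_dvd_mono)
    then have "Suc (Max ?S) \<le> Max ?S"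
      by (intro Max_ge finite_padic_p_powers assms) simp
    then show False by simp
  qed
  with w show thesis by (intro that) (simp_all add: padic_unit_iff)
qed

text \<open>At most \<open>m\<close> of the \<open>m + n\<close> factors p can come from
  \<open>a\<close>; the rest must divide \<open>b\<close>.\<close>

lemma padic_p_power_dvd_multD:
  fixes a b :: "'p::prime_card padic_int"
  assumes "padic_p ^ (m + n) dvd a * b" "\<not> padic_p ^ Suc m dvd a"
  shows "padic_p ^ n dvd b"
proof -
  have "a \<noteq> 0" using assms(2) by auto
  then obtain i w where a: "a = padic_p ^ i * w" and w: "w dvd 1" by (rule padic_decompose)
  have "i \<le> m"
  proof (rule ccontr)
    assume "\<not> i \<le> m"
    then have "padic_p ^ Suc m dvd a" unfolding a by (intro dvd_mult2 le_imp_power_dvd) simp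
    with assms(2) show False by simp
  qed
  then have "padic_p ^ (m + n) = (padic_p ^ i * padic_p ^ (m - i + n) :: 'p padic_int)"
    by (simp flip: power_add)
  then have "padic_p ^ (m - i + n) dvd w * b"
    using assms(1) padic_p_nonzero[where 'p='p] unfolding a by (simp add: mult.assoc)
  then have "padic_p ^ (m - i + n) dvd b"
    using w by (simp add: dvd_mult_unit_iff')
  then show ?thesis by (rule dvd_trans[OF le_imp_power_dvd, rotated]) simp
qed

section \<open>Absolute value and continuity\<close>

lemma padic_abs_mult_unit:
  fixes x u :: "'p::prime_card padic_int"
  assumes "u dvd 1"
  shows "padic_abs (x * u) = padic_abs x"
proof -
  have "padic_p ^ n dvd x * u \<longleftrightarrow> padic_p ^ n dvd x" for n
    using assms by (rule dvd_mult_unit_iff)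
  moreover have "u \<noteq> 0" using assms by auto
  ultimately show ?thesis by (simp add: padic_abs_def)
qed

lemma padic_abs_unit:
  fixes x :: "'p::prime_card padic_int"
  assumes "x dvd 1"
  shows "padic_abs x = 1"
proof -
  have "padic_p ^ n dvd (1 :: 'p padic_int) \<longleftrightarrow> n = 0" for n
    using padic_p_power_dvd_of_nat_iff[of n 1, where 'p='p] prime_gt_1_nat[OF prime_card[where 'a='p]]
    by (auto simp: is_unit_power_iff)
  then have "padic_abs (1 :: 'p padic_int) = 1" by (simp add: padic_abs_def)
  then show ?thesis using padic_abs_mult_unit[OF assms, of 1] by simp
qed

lemma padic_power_small:
  assumes "e > 0"
  obtains n where "(1 / real CARD('p::prime_card)) ^ n < e"
proof -
  have "1 / real CARD('p) < 1" using prime_gt_1_nat[OF prime_card[where 'a='p]] by simp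
  then show thesis using real_arch_pow_inv[OF assms] that by blast
qed

lemma padic_power_pos: "(1 / real CARD('p::prime_card)) ^ n > 0"
  using CARD_pos[where 'p='p] by simp

lemma continuous_on_UNIV_iff_dist:
  fixes f :: "'a::metric_space \<Rightarrow> 'b::metric_space"
  shows "continuous_on UNIV f \<longleftrightarrow>
    (\<forall>s. \<forall>e>0. \<exists>d>0. \<forall>t. dist t s < d \<longrightarrow> dist (f t) (f s) < e)"
proof -
  have "(\<forall>t. t \<noteq> s \<and> dist t s < d \<longrightarrow> dist (f t) (f s) < e) \<longleftrightarrow>
      (\<forall>t. dist t s < d \<longrightarrow> dist (f t) (f s) < e)" if "e > 0" for s d and e :: real
    using that by (metis dist_self)
  then show ?thesis
    by (simp add: continuous_on_eq_continuous_at isCont_def LIM_def cong: imp_cong)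
qed

text \<open>Congruence classes mod p^n are the closed balls of radius (1/p)^n, and these radii tend
  to 0, so exponents can replace epsilon and delta.\<close>

lemma padic_continuous_iff:
  fixes f :: "'p::prime_card padic_int \<Rightarrow> 'p padic_int"
  shows "continuous_on UNIV f \<longleftrightarrow>
    (\<forall>s j. \<exists>k. \<forall>t. padic_p ^ k dvd t - s \<longrightarrow> padic_p ^ j dvd f t - f s)"
proof (intro iffI allI)
  fix s j
  assume "continuous_on UNIV f"
  then have "\<exists>d>0. \<forall>t. padic_abs (t - s) < d \<longrightarrow> padic_abs (f t - f s) < (1 / real CARD('p)) ^ j"
    unfolding continuous_on_UNIV_iff_dist dist_padic_int_def
    using padic_power_pos[where 'p='p, of j] by blast
  then obtain d where "d > 0"
    and d: "\<And>t. padic_abs (t - s) < d \<Longrightarrow> padic_abs (f t - f s) < (1 / real CARD('p)) ^ j"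
    by blast
  obtain k where k: "(1 / real CARD('p)) ^ k < d"
    using padic_power_small[where 'p='p, OF \<open>d > 0\<close>] .
  have "padic_p ^ j dvd f t - f s" if "padic_p ^ k dvd t - s" for t
  proof -
    have "padic_abs (t - s) < d"
      using that k unfolding padic_abs_le_iff[symmetric] by (rule order_le_less_trans)
    from less_imp_le[OF d[OF this]] show ?thesis unfolding padic_abs_le_iff .
  qed
  then show "\<exists>k. \<forall>t. padic_p ^ k dvd t - s \<longrightarrow> padic_p ^ j dvd f t - f s" by blast
next
  assume *: "\<forall>s j. \<exists>k. \<forall>t. padic_p ^ k dvd t - s \<longrightarrow> padic_p ^ j dvd f t - f s"
  show "continuous_on UNIV f"
    unfolding continuous_on_UNIV_iff_dist dist_padic_int_def
  proof (intro allI impI)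
    fix s and e :: real assume "e > 0"
    then obtain j where j: "(1 / real CARD('p)) ^ j < e" by (rule padic_power_small[where 'p='p])
    obtain k where k: "\<And>t. padic_p ^ k dvd t - s \<Longrightarrow> padic_p ^ j dvd f t - f s" using * by blast
    have "padic_abs (f t - f s) < e" if t: "padic_abs (t - s) < (1 / real CARD('p)) ^ k" for t
    proof -
      have "padic_p ^ k dvd t - s" using less_imp_le[OF t] unfolding padic_abs_le_iff .
      from k[OF this] have "padic_abs (f t - f s) \<le> (1 / real CARD('p)) ^ j"
        unfolding padic_abs_le_iff .
      then show ?thesis using j by (rule order_le_less_trans)
    qed
    then show "\<exists>d>0. \<forall>t. padic_abs (t - s) < d \<longrightarrow> padic_abs (f t - f s) < e"
      using padic_power_pos[where 'p='p, of k] by blast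
  qed
qed

section \<open>Newton expansion\<close>

lemma fwd_diff_0 [simp]: "fwd_diff 0 f s = f s"
  by (simp add: fwd_diff_def)

text \<open>Pascal's rule splits the coefficients of order \<open>Suc n\<close> into those of
  \<open>A\<close>, which is the difference at \<open>s + 1\<close>, and those of \<open>B\<close>,
  which together with the term at \<open>g 0\<close> gives minus the difference at
  \<open>s\<close>.\<close>

lemma fwd_diff_Suc: "fwd_diff (Suc n) f s = fwd_diff n f (s + 1) - fwd_diff n f s"
proof -
  define g where "g \<nu> = f (s + of_nat \<nu>)" for \<nu>
  define A where "A = (\<Sum>\<nu>\<le>n. of_nat (n choose \<nu>) * (- 1) ^ (n - \<nu>) * g (Suc \<nu>))"
  define B where "B = (\<Sum>\<nu>\<le>n. of_nat (n choose Suc \<nu>) * (- 1) ^ (n - \<nu>) * g (Suc \<nu>))"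
  have "fwd_diff (Suc n) f s = (- 1) ^ Suc n * g 0 + (A + B)"
    unfolding fwd_diff_def g_def[symmetric] atLeast0AtMost sum.atMost_Suc_shift A_def B_def
      sum.distrib[symmetric]
    by (simp add: algebra_simps)
  also have "A = fwd_diff n f (s + 1)"
    by (simp add: A_def fwd_diff_def g_def atLeast0AtMost algebra_simps)
  also have "(- 1) ^ Suc n * g 0 + (fwd_diff n f (s + 1) + B) =
      fwd_diff n f (s + 1) + (\<Sum>\<nu>\<le>Suc n. of_nat (n choose \<nu>) * (- 1) ^ (Suc n - \<nu>) * g \<nu>)"
    unfolding sum.atMost_Suc_shift B_def by simp
  \<comment> \<open>The term \<open>\<nu> = Suc n\<close> has coefficient 0, and the exponent raised
    by one flips every sign.\<close>
  also have "(\<Sum>\<nu>\<le>Suc n. of_nat (n choose \<nu>) * (- 1) ^ (Suc n - \<nu>) * g \<nu>) = - fwd_diff n f s"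
    unfolding fwd_diff_def g_def[symmetric] atLeast0AtMost
    by (simp add: Suc_diff_le sum_negf[symmetric] binomial_eq_0)
  finally show ?thesis by simp
qed

text \<open>Pascal's rule again. The order \<open>m\<close> is arbitrary because removing one unit
  of the shift raises it by one.\<close>

lemma newton_expansion:
  "fwd_diff m f (s + of_nat h) = (\<Sum>n\<le>h. of_nat (h choose n) * fwd_diff (m + n) f s)"
proof (induction h arbitrary: m)
  case (Suc h)
  let ?F = "\<lambda>n. fwd_diff (m + n) f s"
  have "fwd_diff m f (s + of_nat (Suc h)) = fwd_diff (Suc m) f (s + of_nat h) + fwd_diff m f (s + of_nat h)"
    by (simp add: fwd_diff_Suc algebra_simps)
  also have "\<dots> = (\<Sum>n\<le>h. of_nat (h choose n) * ?F (Suc n)) + (\<Sum>n\<le>Suc h. of_nat (h choose n) * ?F n)"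
    by (simp add: Suc.IH binomial_eq_0)
  also have "\<dots> = (\<Sum>n\<le>Suc h. of_nat (Suc h choose n) * ?F n)"
    unfolding sum.atMost_Suc_shift by (simp add: algebra_simps sum.distrib)
  finally show ?case .
qed simp

text \<open>The coefficients arise from \<open>(h + 1 choose n + 1) = (h + 1) / (n + 1) * (h choose n)\<close>.\<close>

lemma K2_newton_quotient:
  fixes f :: "'p::prime_card padic_int \<Rightarrow> 'p padic_int"
  assumes "f \<in> K2"
  shows "\<exists>e.
    (\<forall>h. f (s + of_nat (Suc h)) - f s = padic_p * of_nat (Suc h) * (\<Sum>n\<le>h. of_nat (h choose n) * e n)) \<and>
    (\<forall>n. padic_p * of_nat (Suc n) * e n = fwd_diff (Suc n) f s) \<and>
    (\<forall>j n. 2 * j \<le> n \<longrightarrow> padic_p ^ j dvd e n)"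
proof -
  have p2: "CARD('p) \<ge> 2" using prime_ge_2_nat[OF prime_card[where 'a='p]] .
  have nz: "(of_nat (Suc n) :: 'p padic_int) \<noteq> 0" for n
    unfolding padic_of_nat_eq_0_iff by simp
  \<comment> \<open>Division by \<open>Suc n\<close> costs at most \<open>n - j\<close> factors p,
    because n + 1 < 2^(n+1-j) whenever 2j \<le> n.\<close>
  have ndvd: "\<not> (padic_p :: 'p padic_int) ^ (n + 1 - j) dvd of_nat (Suc n)" if "2 * j \<le> n" for n j
  proof -
    have "Suc n < 2 ^ (n + 1 - j)"
      using that
    proof (induction n rule: dec_induct)
      case base
      have "Suc (2 * j) < 2 ^ Suc j" by (induction j) auto
      then show ?case by simp
    next
      case (step n)
      then show ?case by (simp add: Suc_diff_le)
    qed
    also have "\<dots> \<le> CARD('p) ^ (n + 1 - j)" using p2 by (rule power_mono) simp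
    finally show ?thesis unfolding padic_p_power_dvd_of_nat_iff using nat_dvd_not_less by blast
  qed
  \<comment> \<open>The difference carries p^(n+1). One p is split off, and the remaining p^n
    absorbs the valuation \<open>i \<le> n\<close> of \<open>Suc n\<close>; \<open>w'\<close>
    inverts its unit part.\<close>
  have "\<exists>c. padic_p * of_nat (Suc n) * c = fwd_diff (Suc n) f s" for n
  proof -
    obtain i w where iw: "(of_nat (Suc n) :: 'p padic_int) = padic_p ^ i * w" and w: "w dvd 1"
      using padic_decompose[OF nz] .
    obtain w' where w': "1 = w * w'" using w by (elim dvdE)
    have "i \<le> n"
    proof (rule ccontr)
      assume "\<not> i \<le> n"
      then have "(padic_p :: 'p padic_int) ^ (n + 1) dvd of_nat (Suc n)"
        unfolding iw by (intro dvd_mult2 le_imp_power_dvd) simp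
      then show False using ndvd[of 0 n] by simp
    qed
    obtain d where d: "fwd_diff (Suc n) f s = padic_p ^ Suc n * d"
      using assms unfolding K2_def by blast
    have "padic_p * of_nat (Suc n) * (padic_p ^ (n - i) * w' * d) =
        padic_p * (padic_p ^ i * padic_p ^ (n - i)) * (w * w') * d"
      unfolding iw by (simp add: algebra_simps)
    also have "\<dots> = padic_p ^ Suc n * d"
      using \<open>i \<le> n\<close> unfolding w'[symmetric] power_add[symmetric] by simp
    finally show ?thesis using d by metis
  qed
  then obtain e where e: "\<And>n. padic_p * of_nat (Suc n) * e n = fwd_diff (Suc n) f s" by metis
  \<comment> \<open>This is the explicit rate at which \<open>e n\<close> tends to 0: p^n divides
    \<open>Suc n * e n\<close>, and \<open>Suc n\<close> uses up at most \<open>n - j\<close>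
    factors.\<close>
  have dvd: "padic_p ^ j dvd e n" if "2 * j \<le> n" for j n
  proof (rule padic_p_power_dvd_multD)
    have "padic_p * padic_p ^ n dvd padic_p * (of_nat (Suc n) * e n)"
      using e[of n] assms unfolding K2_def by (metis (mono_tags, lifting) mem_Collect_eq mult.assoc power_Suc)
    then have "padic_p ^ n dvd of_nat (Suc n) * e n"
      using padic_p_nonzero[where 'p='p] by (simp only: dvd_mult_cancel_left) simp
    then show "padic_p ^ (n - j + j) dvd of_nat (Suc n) * e n" using that by simp
    show "\<not> (padic_p :: 'p padic_int) ^ Suc (n - j) dvd of_nat (Suc n)"
      using ndvd[OF that] that by (simp add: Suc_diff_le)
  qed
  have exp: "f (s + of_nat (Suc h)) - f s = padic_p * of_nat (Suc h) * (\<Sum>n\<le>h. of_nat (h choose n) * e n)" for h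
  proof -
    have "f (s + of_nat (Suc h)) = (\<Sum>n\<le>Suc h. of_nat (Suc h choose n) * fwd_diff n f s)"
      using newton_expansion[of 0 f s "Suc h"] by simp
    then have "f (s + of_nat (Suc h)) - f s = (\<Sum>n\<le>h. of_nat (Suc h choose Suc n) * fwd_diff (Suc n) f s)"
      unfolding sum.atMost_Suc_shift by simp
    also have "\<dots> = (\<Sum>n\<le>h. padic_p * (of_nat (Suc h) * (of_nat (h choose n) * e n)))"
    proof (rule sum.cong[OF refl])
      fix n
      have "of_nat (Suc n) * of_nat (Suc h choose Suc n) = (of_nat (Suc h) * of_nat (h choose n) :: 'p padic_int)"
        unfolding of_nat_mult[symmetric] Suc_times_binomial ..
      then have "padic_p * (of_nat (Suc n) * of_nat (Suc h choose Suc n)) * e n =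
          padic_p * (of_nat (Suc h) * of_nat (h choose n)) * e n"
        by (rule arg_cong)
      then show "of_nat (Suc h choose Suc n) * fwd_diff (Suc n) f s = padic_p * (of_nat (Suc h) * (of_nat (h choose n) * e n))"
        unfolding e[symmetric] by (simp only: ac_simps)
    qed
    finally show ?thesis by (simp only: sum_distrib_left mult.assoc)
  qed
  show ?thesis using exp e dvd by (intro exI[of _ e] conjI allI impI)
qed

section \<open>Binomial coefficients modulo powers of p\<close>

text \<open>In \<open>i * (c choose i) = c * (c - 1 choose (i - 1))\<close>, dividing by
  \<open>i\<close> loses at most \<open>n\<close> factors p, since i < p^(n+1).\<close>

lemma padic_p_power_dvd_choose:
  assumes "(padic_p :: 'p::prime_card padic_int) ^ (j + n) dvd of_nat c" "0 < i" "i \<le> n"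
  shows "(padic_p :: 'p padic_int) ^ j dvd of_nat (c choose i)"
proof (rule padic_p_power_dvd_multD)
  have "of_nat i * of_nat (c choose i) = (of_nat c * of_nat (c - 1 choose (i - 1)) :: 'p padic_int)"
    unfolding of_nat_mult[symmetric] times_binomial_minus1_eq[OF \<open>0 < i\<close>] ..
  then show "(padic_p :: 'p padic_int) ^ (n + j) dvd of_nat i * of_nat (c choose i)"
    using assms(1) by (simp add: add.commute)
  have "i < CARD('p) ^ Suc n"
    using assms(3) power_gt_expt[of "CARD('p)" "Suc n"] prime_gt_1_nat[OF prime_card[where 'a='p]] by simp
  then show "\<not> (padic_p :: 'p padic_int) ^ Suc n dvd of_nat i"
    unfolding padic_p_power_dvd_of_nat_iff using nat_dvd_not_less[OF \<open>0 < i\<close>] by blast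
qed

text \<open>By Vandermonde, replacing \<open>b\<close> by \<open>b + c\<close> only adds terms
  containing \<open>c choose i\<close> with 0 < i \<le> n.\<close>

lemma padic_choose_cong:
  assumes "(padic_p :: 'p::prime_card padic_int) ^ (j + n) dvd of_nat a - of_nat b"
  shows "(padic_p :: 'p padic_int) ^ j dvd of_nat (a choose n) - of_nat (b choose n)"
proof -
  have add: "(padic_p :: 'p padic_int) ^ j dvd of_nat (b + c choose n) - of_nat (b choose n)"
    if c: "(padic_p :: 'p padic_int) ^ (j + n) dvd of_nat c" for b c
  proof -
    have "(of_nat (b + c choose n) :: 'p padic_int) = (\<Sum>i\<le>n. of_nat (c choose i) * of_nat (b choose (n - i)))"
      unfolding add.commute[of b c] vandermonde[symmetric] by simp
    also have "\<dots> = of_nat (b choose n) + (\<Sum>i=1..n. of_nat (c choose i) * of_nat (b choose (n - i)))"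
      unfolding atLeast0AtMost[symmetric] by (subst sum.atLeast_Suc_atMost) simp_all
    finally have "(of_nat (b + c choose n) - of_nat (b choose n) :: 'p padic_int) =
        (\<Sum>i=1..n. of_nat (c choose i) * of_nat (b choose (n - i)))" by simp
    then show ?thesis
      using padic_p_power_dvd_choose[OF c] by (auto intro!: dvd_sum dvd_mult2)
  qed
  show ?thesis
  proof (cases "b \<le> a")
    case True
    then show ?thesis using assms add[of "a - b" b] by (simp add: of_nat_diff)
  next
    case False
    moreover have "(padic_p :: 'p padic_int) ^ (j + n) dvd of_nat b - of_nat a"
      using assms by (rule dvd_diff_swap)
    ultimately have "(padic_p :: 'p padic_int) ^ j dvd of_nat (b choose n) - of_nat (a choose n)"
      using add[of "b - a" a] by (simp add: of_nat_diff)
    then show ?thesis by (rule dvd_diff_swap)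
  qed
qed

text \<open>Terms with n \<ge> 2j vanish mod p^j through \<open>e n\<close>. For the others j + n <
  3j, so their binomials agree mod p^j; hence the exponent \<open>3 * j\<close>.\<close>

lemma newton_series_cong:
  fixes e :: "nat \<Rightarrow> 'p::prime_card padic_int"
  assumes e: "\<And>j n. 2 * j \<le> n \<Longrightarrow> padic_p ^ j dvd e n"
    and ab: "(padic_p :: 'p padic_int) ^ (3 * j) dvd of_nat a - of_nat b"
  shows "padic_p ^ j dvd (\<Sum>n\<le>a. of_nat (a choose n) * e n) - (\<Sum>n\<le>b. of_nat (b choose n) * e n)"
proof -
  \<comment> \<open>Vanishing binomials bring both sums to a common range.\<close>
  have ext: "(\<Sum>n\<le>h. of_nat (h choose n) * e n) = (\<Sum>n\<le>a + b. of_nat (h choose n) * e n)"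
    if "h \<le> a + b" for h
    using that by (intro sum.mono_neutral_left) (auto simp: binomial_eq_0)
  have "padic_p ^ j dvd (of_nat (a choose n) - of_nat (b choose n)) * e n" for n
  proof (cases "2 * j \<le> n")
    case False
    then have "(padic_p :: 'p padic_int) ^ (j + n) dvd of_nat a - of_nat b"
      by (intro dvd_trans[OF le_imp_power_dvd ab]) simp
    then show ?thesis by (intro dvd_mult2 padic_choose_cong)
  qed (simp add: e)
  then show ?thesis
    using ext[of a] ext[of b] by (auto intro!: dvd_sum simp: sum_subtractf[symmetric] left_diff_distrib[symmetric])
qed

section \<open>From \<open>K2\<close> to \<open>K1\<close> and to differentiability\<close>

text \<open>The Newton quotient yields the congruence along natural shifts of \<open>t\<close>;
  continuity at \<open>s\<close> carries it over to \<open>s\<close>.\<close>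

lemma K2_continuous_imp_K1:
  fixes f :: "'p::prime_card padic_int \<Rightarrow> 'p padic_int"
  assumes f: "f \<in> K2" and cont: "continuous_on UNIV f"
  shows "f \<in> K1"
  unfolding K1_def
proof (intro CollectI allI impI)
  fix s t :: "'p padic_int" and n
  assume n: "padic_p ^ n dvd s - t"
  obtain k where k: "\<And>u. padic_p ^ k dvd u - s \<Longrightarrow> padic_p ^ Suc n dvd f u - f s"
    using cont unfolding padic_continuous_iff by blast
  \<comment> \<open>Precision \<open>k\<close> serves continuity at \<open>s\<close>; precision
    \<open>n\<close> lets \<open>h\<close> inherit the divisibility of \<open>s - t\<close>.\<close>
  obtain h where h: "padic_p ^ max k n dvd (s - t) - of_nat h" by (rule padic_nat_approx)
  have hk: "padic_p ^ k dvd (s - t) - of_nat h" "padic_p ^ n dvd (s - t) - of_nat h"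
    by (rule dvd_trans[OF le_imp_power_dvd h]; simp)+
  have 1: "padic_p ^ Suc n dvd f (t + of_nat h) - f s"
    using hk(1) dvd_minus_iff[of "padic_p ^ k" "(s - t) - of_nat h"]
    by (intro k) (simp add: algebra_simps)
  have 2: "padic_p ^ Suc n dvd f (t + of_nat h) - f t"
  proof (cases h)
    case (Suc m)
    have hn: "(padic_p :: 'p padic_int) ^ n dvd of_nat h"
      using dvd_diff[OF n hk(2)] by simp
    obtain e where "f (t + of_nat h) - f t = padic_p * of_nat h * (\<Sum>i\<le>m. of_nat (m choose i) * e i)"
      using K2_newton_quotient[OF f, of t] unfolding Suc by metis
    then show ?thesis using hn by (simp add: mult_dvd_mono dvd_mult2)
  qed simp
  from dvd_diff[OF 2 1] show "padic_p ^ (n + 1) dvd f s - f t" by simp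
qed

text \<open>\<open>L\<close> is the limit of (f(\<xi> + h) - f(\<xi>)) / (p h) over natural h
  tending to 0. The exponent \<open>i\<close> measures \<open>x\<close> and \<open>j\<close> the
  accuracy of the quotient, so the error is relative to \<open>x\<close>.\<close>

lemma K2_derivative:
  fixes f :: "'p::prime_card padic_int \<Rightarrow> 'p padic_int"
  assumes f: "f \<in> K2" and f1: "f \<in> K1"
  shows "\<exists>L. \<forall>x i j. padic_p ^ (3 * j) dvd x \<longrightarrow> padic_p ^ i dvd x \<longrightarrow>
      padic_p ^ Suc (i + j) dvd f (\<xi> + x) - f \<xi> - padic_p * x * L"
proof -
  obtain e where exp: "\<And>h. f (\<xi> + of_nat (Suc h)) - f \<xi> =
        padic_p * of_nat (Suc h) * (\<Sum>n\<le>h. of_nat (h choose n) * e n)"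
    and e: "\<And>j n. 2 * j \<le> n \<Longrightarrow> padic_p ^ j dvd e n"
    using K2_newton_quotient[OF f, of \<xi>] by blast
  \<comment> \<open>\<open>Q h\<close> is the quotient for the shift \<open>Suc h\<close>, not
    \<open>h\<close>.\<close>
  define Q where "Q h = (\<Sum>n\<le>h. of_nat (h choose n) * e n)" for h
  have Q: "padic_p ^ j dvd Q a - Q b" if "(padic_p :: 'p padic_int) ^ (3 * j) dvd of_nat (Suc a) - of_nat (Suc b)" for a b j
    unfolding Q_def using that by (intro newton_series_cong e) simp_all
  \<comment> \<open>The shifts \<open>Suc (a k)\<close> are p^(3k), matching the exponent
    \<open>3 * j\<close>, so consecutive quotients agree mod p^k.\<close>
  define a where "a k = CARD('p) ^ (3 * k) - 1" for k
  have Suc_a: "of_nat (Suc (a k)) = (padic_p :: 'p padic_int) ^ (3 * k)" for k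
  proof -
    have "Suc (a k) = CARD('p) ^ (3 * k)" by (simp add: a_def)
    then show ?thesis by simp
  qed
  have "padic_p ^ k dvd Q (a (Suc k)) - Q (a k)" for k
    by (rule Q) (unfold Suc_a, intro dvd_diff le_imp_power_dvd, simp_all)
  then obtain L where L: "\<And>n. padic_p ^ n dvd L - Q (a n)"
    using padic_complete[of "\<lambda>n. Q (a n)"] by blast
  have QL: "padic_p ^ j dvd Q h - L" if "(padic_p :: 'p padic_int) ^ (3 * j) dvd of_nat (Suc h)" for h j
  proof -
    have "padic_p ^ j dvd Q h - Q (a j)"
      by (rule Q) (unfold Suc_a, intro dvd_diff that dvd_refl)
    from dvd_diff[OF this L[of j]] show ?thesis by simp
  qed
  have "padic_p ^ Suc (i + j) dvd f (\<xi> + x) - f \<xi> - padic_p * x * L"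
    if x: "padic_p ^ (3 * j) dvd x" "padic_p ^ i dvd x" for x i j
  proof -
    \<comment> \<open>At this precision \<open>h\<close> keeps both divisibilities of
      \<open>x\<close>, and \<open>K1\<close> makes the replacement of \<open>x\<close> by
      \<open>h\<close> harmless mod p^(i+j+1).\<close>
    obtain h where h: "padic_p ^ (i + 3 * j) dvd x - of_nat h" by (rule padic_nat_approx)
    have hk: "padic_p ^ k dvd x - of_nat h" if "k \<le> i + 3 * j" for k
      by (rule dvd_trans[OF le_imp_power_dvd[OF that] h])
    have h3: "(padic_p :: 'p padic_int) ^ (3 * j) dvd of_nat h" and hi: "(padic_p :: 'p padic_int) ^ i dvd of_nat h"
      using dvd_diff[OF x(1) hk[of "3 * j"]] dvd_diff[OF x(2) hk[of i]] by simp_all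
    have 1: "padic_p ^ Suc (i + j) dvd f (\<xi> + of_nat h) - f \<xi> - padic_p * of_nat h * L"
    proof (cases h)
      case (Suc m)
      have "f (\<xi> + of_nat h) - f \<xi> - padic_p * of_nat h * L = padic_p * (of_nat h * (Q m - L))"
        using exp[of m] unfolding Suc Q_def[symmetric] by (simp add: algebra_simps)
      moreover have "padic_p ^ i * padic_p ^ j dvd of_nat h * (Q m - L)"
        using hi h3 unfolding Suc by (intro mult_dvd_mono QL)
      ultimately show ?thesis by (simp add: power_add)
    qed simp
    have 2: "padic_p ^ Suc (i + j) dvd f (\<xi> + x) - f (\<xi> + of_nat h)"
      using hk[of "i + j"] by (intro K1D[OF f1]) simp
    have 3: "padic_p ^ Suc (i + j) dvd padic_p * (x - of_nat h) * L"
      using hk[of "i + j"] by (simp add: dvd_mult2 mult_dvd_mono)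
    from dvd_diff[OF dvd_add[OF 2 1] 3] show ?thesis by (simp add: algebra_simps)
  qed
  then show ?thesis by (intro exI[of _ L] allI impI)
qed

section \<open>The class W2\<close>

lemma Delta_res_cong:
  fixes f :: "'p::prime_card padic_int \<Rightarrow> 'p padic_int"
  shows "Delta_res f \<in> {0..<int CARD('p)}" "padic_p dvd of_int (Delta_res f) - Delta_quot f 1"
  using theI'[OF Delta_res_ex1[of f]] unfolding Delta_res_def by blast+

lemma Delta_res_unit:
  fixes f :: "'p::prime_card padic_int \<Rightarrow> 'p padic_int"
  assumes "Delta_res f \<noteq> 0"
  shows "(of_int (Delta_res f) :: 'p padic_int) dvd 1"
proof -
  define d where "d = nat (Delta_res f)"
  have d: "of_int (Delta_res f) = (of_nat d :: 'p padic_int)" "0 < d" "d < CARD('p)"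
    using assms Delta_res_cong(1)[of f] by (auto simp: d_def)
  then have "\<not> CARD('p) ^ 1 dvd d" by (auto dest: dvd_imp_le)
  then show ?thesis unfolding padic_unit_iff d(1) padic_p_power_dvd_of_nat_iff[symmetric] by simp
qed

lemma Delta_quot_mult:
  assumes "f \<in> K2"
  shows "padic_p ^ n * Delta_quot f n = fwd_diff n f 0"
  using assms by (auto simp: K2_def Delta_quot_def)

text \<open>A unit step changes the n-th difference by one of order \<open>Suc n\<close>, which
  p^(n+1) divides. Conditions imposed at 0 thus spread to all natural base points.\<close>

lemma fwd_diff_cong:
  fixes f :: "'p::prime_card padic_int \<Rightarrow> 'p padic_int"
  assumes "f \<in> K2"
  shows "padic_p ^ Suc n dvd fwd_diff n f (of_nat a) - fwd_diff n f 0"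
proof (induction a)
  case (Suc a)
  have "padic_p ^ Suc n dvd fwd_diff (Suc n) f (of_nat a) + (fwd_diff n f (of_nat a) - fwd_diff n f 0)"
    using assms Suc unfolding K2_def by (intro dvd_add) blast+
  then show ?case by (simp add: fwd_diff_Suc add.commute)
qed simp

text \<open>Modulo p the Newton coefficient \<open>e 0\<close> is \<open>Delta_res f\<close> and all
  later ones vanish. This settles natural arguments, and \<open>K1\<close> extends the result to
  all.\<close>

lemma W2_linear_approx:
  fixes f :: "'p::prime_card padic_int \<Rightarrow> 'p padic_int"
  assumes f: "f \<in> W2" and f1: "f \<in> K1" and k: "padic_p ^ k dvd t - s"
  shows "padic_p ^ (k + 2) dvd f t - f s - padic_p * (t - s) * of_int (Delta_res f)"
proof -
  let ?p = "padic_p :: 'p padic_int"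
  let ?d = "of_int (Delta_res f) :: 'p padic_int"
  have f2: "f \<in> K2" using f by (simp add: W2_def)
  have diff1: "?p ^ 2 dvd fwd_diff 1 f (of_nat a) - ?p * ?d" for a
  proof -
    have "?p * ?p dvd ?p * (?d - Delta_quot f 1)"
      using Delta_res_cong(2)[of f] by (intro mult_dvd_mono dvd_refl)
    also have "?p * (?d - Delta_quot f 1) = ?p * ?d - fwd_diff 1 f 0"
      using Delta_quot_mult[OF f2, of 1] by (simp add: right_diff_distrib)
    finally have "?p ^ Suc 1 dvd ?p * ?d - fwd_diff 1 f 0" by simp
    from dvd_diff[OF fwd_diff_cong[OF f2, of 1 a] this]
    have "?p ^ 2 dvd (fwd_diff 1 f (of_nat a) - fwd_diff 1 f 0) - (?p * ?d - fwd_diff 1 f 0)"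
      by (simp only: numeral_2_eq_2 One_nat_def)
    then show ?thesis by simp
  qed
  \<comment> \<open>For p = 2 the second difference is 4e, and \<open>K2\<close> gives only 4 | 4e;
    the evenness of \<open>Delta_quot f 2\<close> supplies the missing factor 2.\<close>
  have diff2: "?p ^ 2 dvd 2 * e"
    if "?p * of_nat (Suc 1) * e = fwd_diff (Suc 1) f (of_nat a)" "CARD('p) = 2" for a e
  proof -
    have "?p ^ 2 * ?p dvd ?p ^ 2 * Delta_quot f 2"
      using f that(2) by (intro mult_dvd_mono dvd_refl) (simp add: W2_def)
    then have "?p ^ 3 dvd fwd_diff 2 f 0"
      unfolding Delta_quot_mult[OF f2] by (simp add: power_numeral_reduce mult.assoc)
    then have "?p ^ 3 dvd (fwd_diff 2 f (of_nat a) - fwd_diff 2 f 0) + fwd_diff 2 f 0"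
      using fwd_diff_cong[OF f2, of 2 a] by (intro dvd_add) (simp_all add: numeral_3_eq_3 numeral_2_eq_2)
    then have "?p * ?p ^ 2 dvd ?p * (2 * e)"
      using that(1) by (simp add: power_numeral_reduce numeral_2_eq_2[symmetric] mult.assoc)
    then show ?thesis using padic_p_nonzero[where 'p='p] by (simp only: dvd_mult_cancel_left) simp
  qed
  have e1: "?p dvd e"
    if e: "?p * of_nat (Suc 1) * e = fwd_diff (Suc 1) f (of_nat a)" for a e
  proof (cases "CARD('p) = 2")
    case True
    have "?p * ?p dvd ?p * e" using diff2[OF e True] True by (simp add: power2_eq_square)
    then show ?thesis using padic_p_nonzero[where 'p='p] by (simp only: dvd_mult_cancel_left) simp
  next
    case False
    \<comment> \<open>For odd p the factor 2 is prime to p, so the \<open>K2\<close> divisibility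
      passes to \<open>e\<close>.\<close>
    have "?p ^ Suc 1 dvd fwd_diff (Suc 1) f (of_nat a)" using f2 unfolding K2_def by blast
    then have "?p * ?p dvd ?p * (of_nat 2 * e)"
      unfolding e[symmetric] by (simp only: power_Suc power_0 mult_1_right One_nat_def numeral_2_eq_2 mult.assoc)
    then have "?p ^ (0 + 1) dvd of_nat 2 * e"
      using padic_p_nonzero[where 'p='p] by (simp only: dvd_mult_cancel_left) simp
    moreover have "\<not> CARD('p) dvd 2"
      using False prime_card[where 'a='p] two_is_prime_nat primes_dvd_imp_eq by blast
    then have "\<not> ?p ^ Suc 0 dvd of_nat 2" unfolding padic_p_power_dvd_of_nat_iff by simp
    ultimately show ?thesis using padic_p_power_dvd_multD by (metis power_one_right)
  qed
  have nat_step: "?p ^ (k + 2) dvd f (of_nat a + of_nat h) - f (of_nat a) - ?p * of_nat h * ?d"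
    if h: "?p ^ k dvd of_nat h" for a h
  proof (cases h)
    case (Suc m)
    obtain e where exp: "\<And>m. f (of_nat a + of_nat (Suc m)) - f (of_nat a) =
        ?p * of_nat (Suc m) * (\<Sum>n\<le>m. of_nat (m choose n) * e n)"
      and e: "\<And>n. ?p * of_nat (Suc n) * e n = fwd_diff (Suc n) f (of_nat a)"
      and ej: "\<And>j n. 2 * j \<le> n \<Longrightarrow> ?p ^ j dvd e n"
      using K2_newton_quotient[OF f2, of "of_nat a"] by blast
    have "?p * ?p dvd ?p * (e 0 - ?d)"
      using diff1[of a] e[of 0] by (simp add: power2_eq_square right_diff_distrib)
    then have e0: "?p dvd e 0 - ?d"
      using padic_p_nonzero[where 'p='p] by (simp only: dvd_mult_cancel_left) simp
    \<comment> \<open>The general rate covers n \<ge> 2; the case n = 1 is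
      \<open>e1\<close>.\<close>
    have "?p dvd e n" if "0 < n" for n
      using that ej[of 1 n] e1[OF e[of 1]] by (cases "n = 1") auto
    then have "?p dvd (\<Sum>n=1..m. of_nat (m choose n) * e n)" by (auto intro!: dvd_sum)
    then have "?p dvd (e 0 - ?d) + (\<Sum>n=1..m. of_nat (m choose n) * e n)" using e0 by (rule dvd_add[rotated])
    also have "\<dots> = (\<Sum>n\<le>m. of_nat (m choose n) * e n) - ?d"
      unfolding atLeast0AtMost[symmetric] by (subst (2) sum.atLeast_Suc_atMost) simp_all
    finally have "?p * ?p ^ k * ?p dvd ?p * of_nat h * ((\<Sum>n\<le>m. of_nat (m choose n) * e n) - ?d)"
      by (intro mult_dvd_mono dvd_refl h)
    then show ?thesis using exp[of m] unfolding Suc by (simp add: right_diff_distrib mult_ac)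
  qed simp
  have nat_case: "?p ^ (k + 2) dvd f (of_nat b) - f (of_nat a) - ?p * (of_nat b - of_nat a) * ?d"
    if ab: "?p ^ k dvd of_nat b - of_nat a" for a b
  proof (cases "a \<le> b")
    case True
    then show ?thesis using nat_step[of "b - a" a] ab by (simp add: of_nat_diff)
  next
    case False
    then have "?p ^ (k + 2) dvd f (of_nat a) - f (of_nat b) - ?p * (of_nat a - of_nat b) * ?d"
      using nat_step[of "a - b" b] dvd_diff_swap[OF ab]
      by (simp add: of_nat_diff)
    then have "?p ^ (k + 2) dvd - (f (of_nat a) - f (of_nat b) - ?p * (of_nat a - of_nat b) * ?d)"
      by (simp only: dvd_minus_iff)
    then show ?thesis by (simp add: algebra_simps)
  qed
  \<comment> \<open>Accuracy \<open>Suc k\<close> becomes \<open>k + 2\<close> after applying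
    \<open>f\<close>.\<close>
  obtain a where a: "?p ^ Suc k dvd s - of_nat a" by (rule padic_nat_approx)
  obtain b where b: "?p ^ Suc k dvd t - of_nat b" by (rule padic_nat_approx)
  have weaken: "?p ^ k dvd x" if "?p ^ Suc k dvd x" for x
    by (rule dvd_trans[OF le_imp_power_dvd that]) simp
  have "?p ^ k dvd (t - s) - (t - of_nat b) + (s - of_nat a)"
    by (rule dvd_add[OF dvd_diff[OF k weaken[OF b]] weaken[OF a]])
  then have 1: "?p ^ (k + 2) dvd f (of_nat b) - f (of_nat a) - ?p * (of_nat b - of_nat a) * ?d"
    by (intro nat_case) simp
  have 2: "?p ^ (k + 2) dvd f s - f (of_nat a)" and 3: "?p ^ (k + 2) dvd f t - f (of_nat b)"
    using K1D[OF f1 a] K1D[OF f1 b] by simp_all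
  have 4: "?p ^ (k + 2) dvd ?p * ((t - of_nat b) - (s - of_nat a)) * ?d"
  proof -
    have "?p * ?p ^ Suc k dvd ?p * ((t - of_nat b) - (s - of_nat a))"
      by (intro mult_dvd_mono dvd_diff[OF b a] dvd_refl)
    then show ?thesis by (simp add: dvd_mult2)
  qed
  from dvd_diff[OF dvd_diff[OF dvd_add[OF 1 3] 2] 4] show ?thesis by (simp add: algebra_simps)
qed

text \<open>A Newton iteration with constant slope: by the linear approximation its step map is a
  contraction.\<close>

lemma W2_zero:
  fixes f :: "'p::prime_card padic_int \<Rightarrow> 'p padic_int"
  assumes f: "f \<in> W2" and f1: "f \<in> K1" and f0: "padic_p dvd f 0"
  obtains \<xi> where "f \<xi> = 0"
proof -
  let ?d = "of_int (Delta_res f) :: 'p padic_int"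
  have "?d dvd 1" using f by (intro Delta_res_unit) (simp add: W2_def)
  then obtain c where c: "1 = ?d * c" by (elim dvdE)
  have "padic_p dvd f s" for s
    using dvd_add[of padic_p "f s - f 0" "f 0"] K1D[OF f1, of 0 s 0] f0 by simp
  then have "\<forall>s. \<exists>g. f s = padic_p * g" by (blast elim: dvdE)
  then obtain g where g: "\<And>s. f s = padic_p * g s" by metis
  \<comment> \<open>Here \<open>g\<close> is f / p and \<open>c\<close> inverts
    \<open>Delta_res f\<close>, so the linear parts of \<open>s\<close> and \<open>c * g s\<close>
    cancel.\<close>
  define F where "F s = s - c * g s" for s
  have "F \<in> K1"
    unfolding K1_def
  proof (intro CollectI allI impI)
    fix s t :: "'p padic_int" and n
    assume "padic_p ^ n dvd s - t"
    from W2_linear_approx[OF f f1 this]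
    have "padic_p * padic_p ^ (n + 1) dvd padic_p * (g s - g t - (s - t) * ?d)"
      unfolding g by (simp add: algebra_simps)
    then have "padic_p ^ (n + 1) dvd g s - g t - (s - t) * ?d"
      using padic_p_nonzero[where 'p='p] by (simp only: dvd_mult_cancel_left) simp
    then have "padic_p ^ (n + 1) dvd - c * (g s - g t - (s - t) * ?d)" by (rule dvd_mult)
    also have "\<dots> = (s - t) * (?d * c) - c * (g s - g t)" by (simp add: algebra_simps)
    also have "\<dots> = F s - F t" unfolding c[symmetric] F_def by (simp add: algebra_simps)
    finally show "padic_p ^ (n + 1) dvd F s - F t" .
  qed
  then obtain \<xi> where "F \<xi> = \<xi>" by (rule K1_fixed_point)
  then have "c = 0 \<or> g \<xi> = 0" by (simp add: F_def)
  moreover have "c \<noteq> 0" using c by auto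
  ultimately have "f \<xi> = 0" by (simp add: g)
  then show thesis by (rule that)
qed

section \<open>Factorization at the zero\<close>

text \<open>The valuation of \<open>x\<close> is exactly \<open>i\<close>, so
  \<open>padic_p * x\<close> accounts for \<open>Suc i\<close> factors and leaves \<open>j\<close>
  for \<open>y\<close>.\<close>

lemma padic_p_power_dvd_cancel:
  fixes x y :: "'p::prime_card padic_int"
  assumes "padic_p ^ Suc (i + j) dvd padic_p * x * y" "x = padic_p ^ i * w" "w dvd 1"
  shows "padic_p ^ j dvd y"
proof -
  have "padic_p ^ Suc i * padic_p ^ j dvd padic_p ^ Suc i * (y * w)"
    using assms(1,2) by (simp add: power_add mult_ac)
  then have "padic_p ^ j dvd y * w"
    using padic_p_nonzero[where 'p='p] by (simp only: dvd_mult_cancel_left) simp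
  then show ?thesis by (simp add: dvd_mult_unit_iff[OF assms(3)])
qed

text \<open>With \<open>i\<close> the valuation of \<open>s - \<xi>\<close>, the error is at most
  (1/p)^j times |s - \<xi>|; \<open>j\<close> is chosen from \<open>\<epsilon>\<close>.\<close>

lemma padic_derivativeI:
  fixes f :: "'p::prime_card padic_int \<Rightarrow> 'p padic_int"
  assumes L: "\<And>x i j. padic_p ^ (3 * j) dvd x \<Longrightarrow> padic_p ^ i dvd x \<Longrightarrow>
      padic_p ^ Suc (i + j) dvd f (\<xi> + x) - f \<xi> - padic_p * x * L"
  shows "has_padic_derivative f (padic_p * L) \<xi>"
  unfolding has_padic_derivative_def
proof (intro allI impI)
  fix \<epsilon> :: real assume "\<epsilon> > 0"
  then obtain j where j: "(1 / real CARD('p)) ^ j < \<epsilon>" by (rule padic_power_small[where 'p='p])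
  have "padic_abs (f s - f \<xi> - padic_p * L * (s - \<xi>)) \<le> \<epsilon> * padic_abs (s - \<xi>)"
    if s: "padic_abs (s - \<xi>) < (1 / real CARD('p)) ^ (3 * j)" for s
  proof (cases "s = \<xi>")
    case False
    then obtain i where i: "padic_abs (s - \<xi>) = (1 / real CARD('p)) ^ i"
      by (auto simp: padic_abs_def)
    have "padic_p ^ (3 * j) dvd s - \<xi>" "padic_p ^ i dvd s - \<xi>"
      using s i by (simp_all flip: padic_abs_le_iff)
    from L[OF this] have "padic_abs (f s - f \<xi> - padic_p * L * (s - \<xi>)) \<le> (1 / real CARD('p)) ^ Suc (i + j)"
      unfolding padic_abs_le_iff by (simp add: mult_ac)
    also have "\<dots> \<le> (1 / real CARD('p)) ^ (i + j)"
      using CARD_pos[where 'p='p] by (intro power_decreasing) auto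
    also have "\<dots> \<le> \<epsilon> * padic_abs (s - \<xi>)"
      using j padic_power_pos[where 'p='p, of i] by (simp add: i power_add mult.commute del: power_one_over)
    finally show ?thesis .
  qed (simp add: padic_abs_def)
  then show "\<exists>\<delta>>0. \<forall>s. padic_abs (s - \<xi>) < \<delta> \<longrightarrow>
      padic_abs (f s - f \<xi> - padic_p * L * (s - \<xi>)) \<le> \<epsilon> * padic_abs (s - \<xi>)"
    using padic_power_pos[where 'p='p, of "3 * j"] by blast
qed

lemma W2_factorization:
  fixes f :: "'p::prime_card padic_int \<Rightarrow> 'p padic_int"
  assumes f: "f \<in> W2" and cont: "continuous_on UNIV f" and f0: "padic_p dvd f 0"
  shows "\<exists>\<xi>. simple_zero f \<xi> \<and> (\<forall>z. f z = 0 \<longrightarrow> z = \<xi>) \<and>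
    (\<exists>fstar :: 'p padic_int \<Rightarrow> 'p padic_int.
      continuous_on UNIV fstar \<and>
      (\<forall>s. fstar s dvd 1) \<and>
      (\<forall>s. padic_p dvd (fstar s - of_int (Delta_res f))) \<and>
      (\<forall>s. f s = padic_p * (s - \<xi>) * fstar s) \<and>
      (\<forall>s. padic_abs (f s) = padic_abs (padic_p * (s - \<xi>))))"
proof -
  let ?p = "padic_p :: 'p padic_int"
  let ?d = "of_int (Delta_res f) :: 'p padic_int"
  have f2: "f \<in> K2" and d: "?d dvd 1" using f by (auto simp: W2_def intro: Delta_res_unit)
  have f1: "f \<in> K1" using f2 cont by (rule K2_continuous_imp_K1)
  obtain \<xi> where \<xi>: "f \<xi> = 0" using W2_zero[OF f f1 f0] .
  obtain L where L: "\<And>x i j. ?p ^ (3 * j) dvd x \<Longrightarrow> ?p ^ i dvd x \<Longrightarrow>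
      ?p ^ Suc (i + j) dvd f (\<xi> + x) - f \<xi> - ?p * x * L"
    using K2_derivative[OF f2 f1, of \<xi>] by blast
  \<comment> \<open>The linear approximation has error p^(i+2), one factor p more than the valuation
    of \<open>?p * (s - \<xi>)\<close>: division is possible and gives \<open>?d\<close> mod
    p.\<close>
  have "\<exists>u. f s = ?p * (s - \<xi>) * u \<and> ?p dvd u - ?d" if "s \<noteq> \<xi>" for s
  proof -
    have "s - \<xi> \<noteq> 0" using that by simp
    then obtain i w where iw: "s - \<xi> = ?p ^ i * w" and w: "w dvd 1" by (rule padic_decompose)
    have "?p ^ (i + 2) dvd f s - f \<xi> - ?p * (s - \<xi>) * ?d"
      by (rule W2_linear_approx[OF f f1]) (simp add: iw)
    then obtain c where c: "f s - ?p * (s - \<xi>) * ?d = ?p ^ (i + 2) * c" by (auto simp: \<xi> elim: dvdE)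
    obtain w' where w': "1 = w * w'" using w by (elim dvdE)
    have "f s = ?p * (s - \<xi>) * ?d + ?p ^ (i + 2) * c * (w * w')"
      unfolding w'[symmetric] c[symmetric] by simp
    also have "\<dots> = ?p * (s - \<xi>) * (?d + ?p * (c * w'))"
      unfolding iw by (simp add: algebra_simps power2_eq_square)
    finally show ?thesis by (intro exI[of _ "?d + ?p * (c * w')"]) simp
  qed
  then obtain u where u: "\<And>s. s \<noteq> \<xi> \<Longrightarrow> f s = ?p * (s - \<xi>) * u s" "\<And>s. s \<noteq> \<xi> \<Longrightarrow> ?p dvd u s - ?d"
    by metis
  \<comment> \<open>The value at \<open>\<xi>\<close> is forced by continuity: the limit of the
    quotients.\<close>
  define fstar where "fstar s = (if s = \<xi> then L else u s)" for s
  have fact: "f s = ?p * (s - \<xi>) * fstar s" for s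
    using u(1)[of s] \<xi> by (simp add: fstar_def)
  \<comment> \<open>Both approximations are compared at the shift p^3, where the derivative estimate
    applies with j = 1; p^5 then divides p^4 (L - ?d).\<close>
  have L_cong: "?p dvd L - ?d"
  proof -
    have 1: "?p ^ 5 dvd f (\<xi> + ?p ^ 3) - f \<xi> - ?p * ?p ^ 3 * L"
      using L[of 1 "?p ^ 3" 3] by simp
    have 2: "?p ^ 5 dvd f (\<xi> + ?p ^ 3) - f \<xi> - ?p * ?p ^ 3 * ?d"
      using W2_linear_approx[OF f f1, of 3 "\<xi> + ?p ^ 3" \<xi>] by simp
    have "?p ^ Suc (3 + 1) dvd ?p * ?p ^ 3 * (L - ?d)"
      using dvd_diff[OF 2 1] by (simp add: right_diff_distrib)
    then have "?p ^ 1 dvd L - ?d" by (rule padic_p_power_dvd_cancel[where w = 1]) simp_all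
    then show ?thesis by simp
  qed
  have cong: "?p dvd fstar s - ?d" for s
    using u(2)[of s] L_cong by (simp add: fstar_def)
  have unit: "fstar s dvd 1" for s
  proof -
    have "\<not> ?p dvd fstar s"
    proof
      assume "?p dvd fstar s"
      from dvd_diff[OF this cong[of s]] have "?p dvd ?d" by simp
      then show False using d by (simp add: padic_unit_iff)
    qed
    then show ?thesis by (simp add: padic_unit_iff)
  qed
  have fstar_nz: "fstar s \<noteq> 0" for s using unit[of s] by auto
  have "\<exists>k. \<forall>t. ?p ^ k dvd t - s \<longrightarrow> ?p ^ j dvd fstar t - fstar s" for s j
  proof (cases "s = \<xi>")
    case True
    have "?p ^ j dvd fstar t - fstar \<xi>" if t: "?p ^ (3 * j) dvd t - \<xi>" for t
    proof (cases "t = \<xi>")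
      case False
      then have "t - \<xi> \<noteq> 0" by simp
      then obtain i w where iw: "t - \<xi> = ?p ^ i * w" and w: "w dvd 1" by (rule padic_decompose)
      have "?p ^ Suc (i + j) dvd f (\<xi> + (t - \<xi>)) - f \<xi> - ?p * (t - \<xi>) * L"
        by (rule L[OF t]) (simp add: iw)
      also have "\<dots> = ?p * (t - \<xi>) * (fstar t - L)"
        using fact[of t] by (simp add: \<xi> right_diff_distrib)
      finally have "?p ^ j dvd fstar t - L" using iw w by (rule padic_p_power_dvd_cancel)
      then show ?thesis by (simp add: fstar_def)
    qed simp
    then show ?thesis using True by blast
  next
    case False
    then have "s - \<xi> \<noteq> 0" by simp
    then obtain i w where iw: "s - \<xi> = ?p ^ i * w" and w: "w dvd 1" by (rule padic_decompose)
    \<comment> \<open>Away from \<open>\<xi>\<close>, dividing by \<open>s - \<xi>\<close> costs the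
      fixed amount \<open>i\<close>, hence the modulus \<open>i + j\<close>.\<close>
    have "?p ^ j dvd fstar t - fstar s" if t: "?p ^ (i + j) dvd t - s" for t
    proof -
      have 1: "?p ^ Suc (i + j) dvd f t - f s" by (rule K1D[OF f1 t])
      have "?p * ?p ^ (i + j) dvd ?p * (t - s)" by (intro mult_dvd_mono dvd_refl t)
      then have 2: "?p ^ Suc (i + j) dvd ?p * (t - s) * fstar t" by (simp add: dvd_mult2)
      have "f t - f s - ?p * (t - s) * fstar t = ?p * (s - \<xi>) * (fstar t - fstar s)"
        unfolding fact[of t] fact[of s] by (simp add: algebra_simps)
      with dvd_diff[OF 1 2] have "?p ^ Suc (i + j) dvd ?p * (s - \<xi>) * (fstar t - fstar s)" by simp
      then show ?thesis using iw w by (rule padic_p_power_dvd_cancel)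
    qed
    then show ?thesis by blast
  qed
  then have "continuous_on UNIV fstar" by (simp add: padic_continuous_iff)
  moreover have "simple_zero f \<xi>"
    using \<xi> padic_derivativeI[OF L] fstar_nz[of \<xi>] padic_p_nonzero[where 'p='p]
    unfolding simple_zero_def by (intro conjI exI[of _ "?p * L"]) (simp_all add: fstar_def)
  moreover have "z = \<xi>" if "f z = 0" for z
    using that fact[of z] fstar_nz[of z] padic_p_nonzero[where 'p='p] by simp
  moreover have "padic_abs (f s) = padic_abs (?p * (s - \<xi>))" for s
    unfolding fact[of s] by (rule padic_abs_mult_unit[OF unit])
  ultimately show ?thesis using unit cong fact by (intro exI[of _ \<xi>] conjI exI[of _ fstar] allI impI)
qed

text \<open>The \<open>K1\<close> condition with n = 0 makes \<open>f\<close> constant mod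
  p.\<close>

lemma K1_unit_valued:
  fixes f :: "'p::prime_card padic_int \<Rightarrow> 'p padic_int"
  assumes f: "f \<in> K1" and f0: "f 0 dvd 1"
  shows "f s dvd 1"
proof -
  have 1: "padic_p dvd f s - f 0" using K1D[OF f, of 0 s 0] by simp
  have "\<not> padic_p dvd f s"
  proof
    assume "padic_p dvd f s"
    from dvd_diff[OF this 1] show False using f0 by (simp add: padic_unit_iff)
  qed
  then show ?thesis by (simp add: padic_unit_iff)
qed

theorem theorem4p5:
  fixes f :: "'p::prime_card padic_int \<Rightarrow> 'p padic_int"
  shows
    "(f \<in> K1 \<or> (f \<in> K2 \<and> continuous_on UNIV f) \<longrightarrow> (\<exists>\<tau>. f \<tau> = \<tau>)) \<and>
     ((f \<in> K1 \<or> (f \<in> K2 \<and> continuous_on UNIV f)) \<and> f 0 dvd 1 \<longrightarrow>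
        (\<forall>s. padic_abs (f s) = 1)) \<and>
     (f \<in> W2 \<and> continuous_on UNIV f \<and> padic_p dvd f 0 \<longrightarrow>
        (\<exists>\<xi>. simple_zero f \<xi> \<and> (\<forall>z. f z = 0 \<longrightarrow> z = \<xi>) \<and>
           (\<exists>fstar :: 'p padic_int \<Rightarrow> 'p padic_int.
              continuous_on UNIV fstar \<and>
              (\<forall>s. fstar s dvd 1) \<and>
              (\<forall>s. padic_p dvd (fstar s - of_int (Delta_res f))) \<and>
              (\<forall>s. f s = padic_p * (s - \<xi>) * fstar s) \<and>
              (\<forall>s. padic_abs (f s) = padic_abs (padic_p * (s - \<xi>))))))"
proof (intro conjI impI allI)
  assume "f \<in> K1 \<or> (f \<in> K2 \<and> continuous_on UNIV f)"
  \<comment> \<open>Both alternatives reduce to \<open>K1\<close>.\<close>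
  then have "f \<in> K1" using K2_continuous_imp_K1 by blast
  then show "\<exists>\<tau>. f \<tau> = \<tau>" using K1_fixed_point by blast
next
  fix s
  assume "(f \<in> K1 \<or> (f \<in> K2 \<and> continuous_on UNIV f)) \<and> f 0 dvd 1"
  then have "f \<in> K1" "f 0 dvd 1" using K2_continuous_imp_K1 by blast+
  then show "padic_abs (f s) = 1" by (rule padic_abs_unit[OF K1_unit_valued])
qed (use W2_factorization[of f] in blast)

end
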